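(* Let $\Omega=\{-1,1\}^{\mathbb{N}}$ with the shift map $T$, let $\alpha>2$ and let $\Phi((x_i)_{i\ge1})=x_1\sum_{n=1}^\infty n^{-\alpha}x_{n+1}$ be the Dyson potential. Let $P(s)=\lim_{n\to\infty}\frac1n\log\mathcal{L}^n_{s\Phi}(\mathbf 1)(z_0)$ be its pressure function. Then $P(s)$ is increasing for $s\ge0$. Furthermore, $P'(0)=0$, $P(0)=\log2$ and $P(s)>s\max\Phi$ for all $s\ge0$.
   Context: $T((x_i)_{i\ge1})=(x_{i+1})_{i\ge1}$; $\mathcal{L}_{b}(f)(x)=\sum_{T(y)=x}e^{b(y)}f(y)$ for continuous $b,f:\Omega\to\mathbb{R}$; the limit defining $P(s)$ exists and does not depend on $z_0\in\Omega$. *)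

theory Defs
  imports "HOL-Analysis.Analysis"
begin

text \<open>
  Sequences are indexed from 0: the symbol \<open>x\<^sub>i\<close> with \<open>i \<ge> 1\<close> is \<open>x (i - 1)\<close>.
\<close>

definition Omega :: "(nat \<Rightarrow> real) set" where
  "Omega = {x. \<forall>i. x i \<in> {-1, 1}}"

definition shift :: "(nat \<Rightarrow> real) \<Rightarrow> nat \<Rightarrow> real" where
  "shift x = (\<lambda>i. x (Suc i))"

text \<open>
  The term with summation index \<open>n\<close> below is \<open>(n + 1) powr - \<alpha>\<close> times the symbol
  \<open>x\<^sub>n\<^sub>+\<^sub>2\<close>, so the index of the usual formula is \<open>n + 1\<close>.
\<close>

definition dyson :: "real \<Rightarrow> (nat \<Rightarrow> real) \<Rightarrow> real" where
  "dyson \<alpha> x = x 0 * (\<Sum>n. real (Suc n) powr (- \<alpha>) * x (Suc n))"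

definition transfer_op ::
    "((nat \<Rightarrow> real) \<Rightarrow> real) \<Rightarrow> ((nat \<Rightarrow> real) \<Rightarrow> real) \<Rightarrow> (nat \<Rightarrow> real) \<Rightarrow> real" where
  "transfer_op b f = (\<lambda>x. \<Sum>y\<in>{y \<in> Omega. shift y = x}. exp (b y) * f y)"

text \<open>
  The base point \<open>z\<^sub>0\<close> is kept as a parameter, although the limit does not depend on it
  for \<open>\<alpha> > 2\<close> and \<open>z\<^sub>0 \<in> Omega\<close>.
\<close>

definition pressure :: "real \<Rightarrow> (nat \<Rightarrow> real) \<Rightarrow> real \<Rightarrow> real" where
  "pressure \<alpha> z\<^sub>0 s =
     lim (\<lambda>n. 1 / real n * ln ((transfer_op (\<lambda>x. s * dyson \<alpha> x) ^^ n) (\<lambda>_. 1) z\<^sub>0))"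

end

theory Submission
  imports Defs
begin

text \<open>
  The iterate \<open>A\<^sub>n(z) = L\<^sup>n 1 (z)\<close> is the sum of \<open>exp (s S\<^sub>n \<Phi>)\<close> over the \<open>n\<close>-step preimages of \<open>z\<close>. Since
  \<open>\<alpha> > 2\<close>, the Birkhoff sums \<open>S\<^sub>n \<Phi>\<close> depend on the symbols beyond the first \<open>n\<close> only up to a constant.
  Hence \<open>ln A\<^sub>n\<close> is superadditive up to a constant, and Fekete's argument gives both the limit \<open>P\<close> and
  \<open>ln A\<^sub>n \<le> n P + K\<close>.

  With \<open>\<zeta> = max \<Phi>\<close>, Jensen's inequality over the interaction range gives \<open>A\<^sub>n \<le> (2 cosh (s \<zeta>))\<^sup>n\<close>, while
  \<open>L\<^sup>2 1 \<ge> 4 cosh s\<close> pointwise; so \<open>P\<close> lies between \<open>ln 2 + ln (cosh s) / 2\<close> and \<open>ln 2 + ln (cosh (s \<zeta>))\<close>,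
  which settles the behaviour at \<open>0\<close>. The power mean inequality shows that \<open>(P(s) - ln 2) / s\<close> is nondecreasing,
  and with \<open>P > ln 2\<close> off \<open>0\<close> strict monotonicity follows. Finally the \<open>n\<close> words with at most one domain
  wall give \<open>ln A\<^sub>n \<ge> ln n + s n \<zeta> - const\<close>, and \<open>ln n\<close> eventually beats all the constants.
\<close>

section \<open>Iterates of transfer operators\<close>

definition fiber :: "nat \<Rightarrow> (nat \<Rightarrow> real) \<Rightarrow> (nat \<Rightarrow> real) set" where
  "fiber n z = {y \<in> Omega. (shift ^^ n) y = z}"

definition birkhoff :: "((nat \<Rightarrow> real) \<Rightarrow> real) \<Rightarrow> nat \<Rightarrow> (nat \<Rightarrow> real) \<Rightarrow> real" where
  "birkhoff b n y = (\<Sum>i<n. b ((shift ^^ i) y))"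

lemma funpow_shift: "(shift ^^ n) y = (\<lambda>i. y (i + n))"
  by (induction n) (auto simp: shift_def)

lemma Omega_cases: "x \<in> Omega \<Longrightarrow> x i = -1 \<or> x i = 1"
  by (auto simp: Omega_def)

lemma abs_Omega: "x \<in> Omega \<Longrightarrow> \<bar>x i\<bar> = 1"
  using Omega_cases[of x i] by auto

lemma funpow_shift_Omega: "x \<in> Omega \<Longrightarrow> (shift ^^ n) x \<in> Omega"
  by (auto simp: Omega_def funpow_shift)

lemma case_nat_Omega: "x \<in> Omega \<Longrightarrow> case_nat 1 x \<in> Omega" "x \<in> Omega \<Longrightarrow> case_nat (-1) x \<in> Omega"
  by (auto simp: Omega_def split: nat.splits)

lemma shift_preimage:
  assumes "z \<in> Omega"
  shows "{y \<in> Omega. shift y = z} = {case_nat (-1) z, case_nat 1 z}"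
proof -
  have "y = case_nat (y 0) (shift y)" for y
    by (rule ext) (auto simp: shift_def split: nat.splits)
  then have "y \<in> {case_nat (-1) z, case_nat 1 z}" if "y \<in> Omega" "shift y = z" for y
    using that Omega_cases[of y 0] by (metis insertCI)
  moreover have "shift (case_nat a z) = z" for a
    by (auto simp: shift_def)
  ultimately show ?thesis
    using case_nat_Omega[OF assms] by auto
qed

lemma transfer_op_Omega:
  assumes "z \<in> Omega"
  shows "transfer_op b f z =
    exp (b (case_nat (-1) z)) * f (case_nat (-1) z) + exp (b (case_nat 1 z)) * f (case_nat 1 z)"
proof -
  have "case_nat (-1) z \<noteq> case_nat (1::real) z"
    by (metis old.nat.simps(4) one_neq_neg_one)
  then show ?thesis
    unfolding transfer_op_def shift_preimage[OF assms] by simp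
qed

lemma finite_fiber: "z \<in> Omega \<Longrightarrow> finite (fiber n z)"
proof (induction n arbitrary: z)
  case (Suc n)
  have "fiber (Suc n) z \<subseteq> fiber n (case_nat (-1) z) \<union> fiber n (case_nat 1 z)"
  proof
    fix y assume y: "y \<in> fiber (Suc n) z"
    then have "(shift ^^ n) y \<in> {y \<in> Omega. shift y = z}"
      by (auto simp: fiber_def funpow_shift_Omega)
    then show "y \<in> fiber n (case_nat (-1) z) \<union> fiber n (case_nat 1 z)"
      using y unfolding shift_preimage[OF Suc.prems] by (auto simp: fiber_def)
  qed
  then show ?case
    using Suc.IH case_nat_Omega[OF Suc.prems] finite_subset by blast
qed (auto simp: fiber_def)

lemma birkhoff_Suc: "birkhoff b (Suc n) y = birkhoff b n y + b ((shift ^^ n) y)"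
  by (simp add: birkhoff_def)

lemma birkhoff_add: "birkhoff b (m + n) y = birkhoff b m y + birkhoff b n ((shift ^^ m) y)"
  by (induction n) (auto simp: birkhoff_def funpow_shift ac_simps)

lemma birkhoff_mult: "birkhoff (\<lambda>x. s * b x) n y = s * birkhoff b n y"
  by (simp add: birkhoff_def sum_distrib_left)

text \<open>Every point of \<open>fiber (Suc n) z\<close> reaches exactly one one-step preimage of
  \<open>z\<close> after \<open>n\<close> shifts, so the inner fibers partition the outer
  one.\<close>

lemma funpow_transfer_op:
  "z \<in> Omega \<Longrightarrow> (transfer_op b ^^ n) f z = (\<Sum>y\<in>fiber n z. exp (birkhoff b n y) * f y)"
proof (induction n arbitrary: z)
  case 0
  then have "fiber 0 z = {z}" by (auto simp: fiber_def)
  then show ?case by (simp add: birkhoff_def)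
next
  case (Suc n)
  let ?P = "{y \<in> Omega. shift y = z}"
  have "(transfer_op b ^^ Suc n) f z = (\<Sum>x\<in>?P. exp (b x) * (transfer_op b ^^ n) f x)"
    by (simp add: transfer_op_def)
  also have "\<dots> = (\<Sum>x\<in>?P. \<Sum>y\<in>fiber n x. exp (birkhoff b (Suc n) y) * f y)"
    by (intro sum.cong refl)
      (auto simp: Suc.IH sum_distrib_left fiber_def birkhoff_Suc exp_add intro!: sum.cong)
  also have "\<dots> = (\<Sum>x\<in>?P. \<Sum>y\<in>{y. y \<in> fiber (Suc n) z \<and> (shift ^^ n) y = x}. exp (birkhoff b (Suc n) y) * f y)"
    by (intro sum.cong refl) (auto simp: fiber_def)
  also have "\<dots> = (\<Sum>y\<in>fiber (Suc n) z. exp (birkhoff b (Suc n) y) * f y)"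
  proof (rule sum.group)
    show "finite (fiber (Suc n) z)" by (rule finite_fiber[OF Suc.prems])
    show "finite ?P" by (simp add: shift_preimage[OF Suc.prems])
    show "(shift ^^ n) ` fiber (Suc n) z \<subseteq> ?P" by (auto simp: fiber_def funpow_shift_Omega)
  qed
  finally show ?case .
qed

lemma funpow_transfer_op_mono:
  assumes "\<And>y. y \<in> Omega \<Longrightarrow> f y \<le> g y" and "z \<in> Omega"
  shows "(transfer_op b ^^ n) f z \<le> (transfer_op b ^^ n) g z"
  unfolding funpow_transfer_op[OF assms(2)]
  by (intro sum_mono mult_left_mono assms(1)) (auto simp: fiber_def)

lemma funpow_transfer_op_const:
  assumes "z \<in> Omega"
  shows "(transfer_op b ^^ n) (\<lambda>_. c) z = (transfer_op b ^^ n) (\<lambda>_. 1) z * c"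
  by (simp add: funpow_transfer_op[OF assms] sum_distrib_right)

text \<open>Positivity of the operator lets a pointwise bound on a block of \<open>k\<close> steps
  be applied block after block; it is needed for \<open>k = 2\<close>.\<close>

lemma funpow_transfer_op_power_ge:
  assumes k: "\<And>y. y \<in> Omega \<Longrightarrow> c \<le> (transfer_op b ^^ k) (\<lambda>_. 1) y" and "c \<ge> 0" and "z \<in> Omega"
  shows "c ^ n \<le> (transfer_op b ^^ (n * k)) (\<lambda>_. 1) z"
  using \<open>z \<in> Omega\<close>
proof (induction n arbitrary: z)
  case (Suc n)
  have "c ^ Suc n \<le> (transfer_op b ^^ k) (\<lambda>_. 1) z * c ^ n"
    using k[OF Suc.prems] \<open>c \<ge> 0\<close> by (simp add: mult_right_mono)
  also have "\<dots> = (transfer_op b ^^ k) (\<lambda>_. c ^ n) z"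
    by (rule funpow_transfer_op_const[OF Suc.prems, symmetric])
  also have "\<dots> \<le> (transfer_op b ^^ k) ((transfer_op b ^^ (n * k)) (\<lambda>_. 1)) z"
    by (intro funpow_transfer_op_mono Suc)
  finally show ?case
    by (simp add: funpow_add)
qed auto

lemma funpow_transfer_op_eq_power:
  assumes "\<And>y. y \<in> Omega \<Longrightarrow> transfer_op b (\<lambda>_. 1) y = c" and "z \<in> Omega"
  shows "(transfer_op b ^^ n) (\<lambda>_. 1) z = c ^ n"
  using assms(2)
proof (induction n arbitrary: z)
  case (Suc n)
  have "(transfer_op b ^^ Suc n) (\<lambda>_. 1) z = transfer_op b (\<lambda>_. c ^ n) z"
    using Suc.IH case_nat_Omega[OF Suc.prems] by (simp add: transfer_op_Omega[OF Suc.prems])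
  also have "\<dots> = c ^ Suc n"
    using funpow_transfer_op_const[OF Suc.prems, where b = b and n = 1 and c = "c ^ n"] assms(1)[OF Suc.prems] by simp
  finally show ?case .
qed auto

text \<open>For the zero potential the iterate merely counts preimages, and each step contributes a
  factor 2.\<close>

lemma card_fiber:
  assumes "z \<in> Omega"
  shows "real (card (fiber n z)) = 2 ^ n"
proof -
  have "(transfer_op (\<lambda>_. 0) ^^ n) (\<lambda>_. 1) z = 2 ^ n"
    by (rule funpow_transfer_op_eq_power[OF _ assms]) (simp add: transfer_op_Omega)
  then show ?thesis
    by (simp add: funpow_transfer_op[OF assms] birkhoff_def)
qed

lemma fiber_nonempty: "z \<in> Omega \<Longrightarrow> fiber n z \<noteq> {}"
  using card_fiber[of z n] by auto

lemma funpow_transfer_op_pos: "z \<in> Omega \<Longrightarrow> (transfer_op b ^^ n) (\<lambda>_. 1) z > 0"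
  by (simp add: funpow_transfer_op finite_fiber fiber_nonempty sum_pos)


section \<open>Correlation expansion of the Dyson potential\<close>

definition dyson_weight :: "real \<Rightarrow> nat \<Rightarrow> real" where
  "dyson_weight \<alpha> k = real (Suc k) powr (- \<alpha>)"

text \<open>Unnormalized autocorrelation of the first \<open>n\<close> sites at lag
  \<open>Suc k\<close>, the lag that carries the weight \<open>dyson_weight \<alpha> k\<close>. The
  right partner may lie beyond the window.\<close>

definition corr :: "nat \<Rightarrow> nat \<Rightarrow> (nat \<Rightarrow> real) \<Rightarrow> real" where
  "corr n k y = (\<Sum>i<n. y i * y (i + Suc k))"

definition dyson_sum :: "real \<Rightarrow> real" where
  "dyson_sum \<alpha> = (\<Sum>k. dyson_weight \<alpha> k)"

text \<open>First moment of the interaction. It controls the energy across a cut, since at most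
  \<open>Suc k\<close> pairs of lag \<open>Suc k\<close> straddle one.\<close>

definition dyson_moment :: "real \<Rightarrow> real" where
  "dyson_moment \<alpha> = (\<Sum>k. dyson_weight \<alpha> k * real (Suc k))"

lemma dyson_weight_pos: "dyson_weight \<alpha> k > 0"
  by (simp add: dyson_weight_def)

text \<open>The terms are powers with exponent \<open>1 - \<alpha>\<close>, which is below -1
  because \<open>\<alpha> > 2\<close>.\<close>

lemma summable_dyson_moment:
  assumes "\<alpha> > 2"
  shows "summable (\<lambda>k. dyson_weight \<alpha> k * real (Suc k))"
proof -
  have "summable (\<lambda>k. real (Suc k) powr (1 - \<alpha>))"
    using assms summable_Suc_iff[of "\<lambda>k. real k powr (1 - \<alpha>)"] summable_real_powr_iff[of "1 - \<alpha>"]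
    by simp
  moreover have "dyson_weight \<alpha> k * real (Suc k) = real (Suc k) powr (1 - \<alpha>)" for k
    using powr_add[of "real (Suc k)" "-\<alpha>" 1] by (simp add: dyson_weight_def)
  ultimately show ?thesis by simp
qed

lemma summable_dyson_weight:
  assumes "\<alpha> > 2"
  shows "summable (dyson_weight \<alpha>)"
proof (rule summable_comparison_test[OF _ summable_dyson_moment[OF assms]])
  have "norm (dyson_weight \<alpha> n) \<le> dyson_weight \<alpha> n * real (Suc n)" for n
    using dyson_weight_pos[of \<alpha> n] by simp
  then show "\<exists>N. \<forall>n\<ge>N. norm (dyson_weight \<alpha> n) \<le> dyson_weight \<alpha> n * real (Suc n)"
    by blast
qed

lemma dyson_sum_pos: "\<alpha> > 2 \<Longrightarrow> dyson_sum \<alpha> > 0"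
  unfolding dyson_sum_def by (intro suminf_pos summable_dyson_weight dyson_weight_pos)

lemma summable_dyson_weight_bounded:
  assumes "\<alpha> > 2" and "\<And>k. \<bar>c k\<bar> \<le> B"
  shows "summable (\<lambda>k. dyson_weight \<alpha> k * c k)"
proof (rule summable_comparison_test)
  show "summable (\<lambda>k. dyson_weight \<alpha> k * B)"
    by (intro summable_mult2 summable_dyson_weight assms(1))
  show "\<exists>N. \<forall>k\<ge>N. norm (dyson_weight \<alpha> k * c k) \<le> dyson_weight \<alpha> k * B"
    using assms(2) by (simp add: abs_mult dyson_weight_def mult_left_mono)
qed

lemma dyson_funpow_shift:
  assumes "\<alpha> > 2" and "y \<in> Omega"
  shows "dyson \<alpha> ((shift ^^ i) y) = (\<Sum>k. dyson_weight \<alpha> k * (y i * y (i + Suc k)))"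
    and "summable (\<lambda>k. dyson_weight \<alpha> k * (y i * y (i + Suc k)))"
proof -
  have s: "summable (\<lambda>k. dyson_weight \<alpha> k * y (i + Suc k))"
    by (rule summable_dyson_weight_bounded[OF assms(1), where B = 1]) (simp add: abs_Omega[OF assms(2)])
  show "summable (\<lambda>k. dyson_weight \<alpha> k * (y i * y (i + Suc k)))"
    using summable_mult[OF s, of "y i"] by (simp add: mult_ac)
  show "dyson \<alpha> ((shift ^^ i) y) = (\<Sum>k. dyson_weight \<alpha> k * (y i * y (i + Suc k)))"
    using suminf_mult[OF s, of "y i"]
    by (simp add: dyson_def funpow_shift dyson_weight_def ac_simps)
qed

text \<open>The finite sum over sites is exchanged with the series over lags, which collects all
  pairs of equal lag.\<close>

lemma birkhoff_dyson:
  assumes "\<alpha> > 2" and "y \<in> Omega"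
  shows "birkhoff (dyson \<alpha>) n y = (\<Sum>k. dyson_weight \<alpha> k * corr n k y)"
    and "summable (\<lambda>k. dyson_weight \<alpha> k * corr n k y)"
proof -
  have eq: "dyson_weight \<alpha> k * corr n k y = (\<Sum>i<n. dyson_weight \<alpha> k * (y i * y (i + Suc k)))" for k
    by (simp add: corr_def sum_distrib_left)
  show "birkhoff (dyson \<alpha>) n y = (\<Sum>k. dyson_weight \<alpha> k * corr n k y)"
    unfolding eq birkhoff_def dyson_funpow_shift(1)[OF assms]
    by (rule suminf_sum[symmetric]) (rule dyson_funpow_shift(2)[OF assms])
  show "summable (\<lambda>k. dyson_weight \<alpha> k * corr n k y)"
    unfolding eq by (rule summable_sum) (rule dyson_funpow_shift(2)[OF assms])
qed

lemma abs_mult_Omega: "y \<in> Omega \<Longrightarrow> \<bar>y i * y j\<bar> = 1"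
  by (simp add: abs_mult abs_Omega)

text \<open>Only pairs whose right end leaves the window can differ. There are at most
  \<open>Suc k\<close> of them, and each product changes by at most 2.\<close>

lemma corr_diff:
  assumes y: "y \<in> Omega" "y' \<in> Omega" and eq: "\<And>i. i < n \<Longrightarrow> y i = y' i"
  shows "\<bar>corr n k y - corr n k y'\<bar> \<le> 2 * real (Suc k)"
proof -
  have "\<bar>corr n k y - corr n k y'\<bar> = \<bar>\<Sum>i<n. y i * y (i + Suc k) - y' i * y' (i + Suc k)\<bar>"
    by (simp add: corr_def sum_subtractf)
  also have "\<dots> \<le> (\<Sum>i<n. \<bar>y i * y (i + Suc k) - y' i * y' (i + Suc k)\<bar>)"
    by (rule sum_abs)
  also have "\<dots> \<le> (\<Sum>i<n. if n \<le> i + Suc k then 2 else 0)"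
  proof (rule sum_mono)
    fix i assume "i \<in> {..<n}"
    then show "\<bar>y i * y (i + Suc k) - y' i * y' (i + Suc k)\<bar> \<le> (if n \<le> i + Suc k then 2 else 0)"
      using eq[of i] eq[of "i + Suc k"] abs_mult_Omega[OF y(1), of i "i + Suc k"]
        abs_mult_Omega[OF y(2), of i "i + Suc k"] by auto
  qed
  also have "\<dots> = 2 * real (card {i. i < n \<and> n \<le> i + Suc k})"
    by (subst sum.inter_filter[symmetric]) auto
  also have "card {i. i < n \<and> n \<le> i + Suc k} \<le> card {n - Suc k..<n}"
    by (rule card_mono) auto
  then have "2 * real (card {i. i < n \<and> n \<le> i + Suc k}) \<le> 2 * real (Suc k)"
    by simp
  finally show ?thesis .
qed

lemma birkhoff_dyson_distortion:
  assumes "\<alpha> > 2" and y: "y \<in> Omega" "y' \<in> Omega" and eq: "\<And>i. i < n \<Longrightarrow> y i = y' i"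
  shows "\<bar>birkhoff (dyson \<alpha>) n y - birkhoff (dyson \<alpha>) n y'\<bar> \<le> 2 * dyson_moment \<alpha>"
proof -
  let ?d = "\<lambda>k. dyson_weight \<alpha> k * corr n k y - dyson_weight \<alpha> k * corr n k y'"
  have le: "\<bar>?d k\<bar> \<le> 2 * (dyson_weight \<alpha> k * real (Suc k))" for k
  proof -
    have "\<bar>?d k\<bar> = dyson_weight \<alpha> k * \<bar>corr n k y - corr n k y'\<bar>"
      using dyson_weight_pos[of \<alpha> k] by (simp add: abs_mult flip: right_diff_distrib)
    also have "\<dots> \<le> dyson_weight \<alpha> k * (2 * real (Suc k))"
      using dyson_weight_pos[of \<alpha> k] by (intro mult_left_mono corr_diff y eq) auto
    finally show ?thesis by (simp only: mult.left_commute)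
  qed
  have s: "summable (\<lambda>k. 2 * (dyson_weight \<alpha> k * real (Suc k)))"
    by (intro summable_mult summable_dyson_moment assms(1))
  have "birkhoff (dyson \<alpha>) n y - birkhoff (dyson \<alpha>) n y' = suminf ?d"
    unfolding birkhoff_dyson(1)[OF assms(1) y(1)] birkhoff_dyson(1)[OF assms(1) y(2)]
    by (intro suminf_diff birkhoff_dyson(2) assms(1) y)
  also have "\<bar>\<dots>\<bar> \<le> (\<Sum>k. 2 * (dyson_weight \<alpha> k * real (Suc k)))"
    using norm_suminf_le[of ?d, OF _ s] le by simp
  also have "\<dots> = 2 * dyson_moment \<alpha>"
    unfolding dyson_moment_def by (rule suminf_mult[OF summable_dyson_moment[OF assms(1)]])
  finally show ?thesis .
qed

section \<open>Ground states and the maximum of the potential\<close>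

lemma const_Omega: "(\<lambda>_. 1) \<in> Omega" "(\<lambda>_. -1) \<in> Omega"
  by (auto simp: Omega_def)

lemma birkhoff_dyson_const:
  assumes "\<alpha> > 2" and "c = 1 \<or> c = -1"
  shows "birkhoff (dyson \<alpha>) n (\<lambda>_. c) = real n * dyson_sum \<alpha>"
proof -
  have "corr n k (\<lambda>_. c) = real n" for k
    using assms(2) by (auto simp: corr_def)
  moreover have "(\<lambda>_. c) \<in> Omega"
    using assms(2) const_Omega by auto
  ultimately have "birkhoff (dyson \<alpha>) n (\<lambda>_. c) = (\<Sum>k. dyson_weight \<alpha> k * real n)"
    using birkhoff_dyson(1)[OF assms(1)] by simp
  then show ?thesis
    using suminf_mult2[OF summable_dyson_weight[OF assms(1)], of "real n"]
    by (simp add: dyson_sum_def mult.commute)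
qed

lemma dyson_le_dyson_sum:
  assumes "\<alpha> > 2" and "y \<in> Omega"
  shows "dyson \<alpha> y \<le> dyson_sum \<alpha>"
proof -
  have "corr 1 k y \<le> 1" for k
    using abs_mult_Omega[OF assms(2), of 0 "Suc k"] by (simp add: corr_def)
  then have "dyson_weight \<alpha> k * corr 1 k y \<le> dyson_weight \<alpha> k" for k
    using dyson_weight_pos[of \<alpha> k] by (simp add: mult_left_le)
  then have "birkhoff (dyson \<alpha>) 1 y \<le> dyson_sum \<alpha>"
    unfolding birkhoff_dyson(1)[OF assms] dyson_sum_def
    by (intro suminf_le birkhoff_dyson(2) assms summable_dyson_weight)
  then show ?thesis
    by (simp add: birkhoff_def)
qed

lemma Greatest_dyson:
  assumes "\<alpha> > 2"
  shows "(GREATEST v. v \<in> dyson \<alpha> ` Omega) = dyson_sum \<alpha>"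
proof (rule Greatest_equality)
  have "dyson \<alpha> (\<lambda>_. 1) = dyson_sum \<alpha>"
    using birkhoff_dyson_const[OF assms, of 1 1] by (simp add: birkhoff_def)
  then show "dyson_sum \<alpha> \<in> dyson \<alpha> ` Omega"
    using const_Omega(1) by (intro image_eqI[where x = "\<lambda>_. 1"]) auto
qed (auto simp: dyson_le_dyson_sum[OF assms])


section \<open>Superadditive sequences and convexity inequalities\<close>

text \<open>Subtracting \<open>K\<close> makes the sequence superadditive, so Fekete's argument
  applies. As the limit is a supremum, it also gives a bound at every finite
  \<open>n\<close>.\<close>

lemma quasi_superadditive_limit:
  fixes a :: "nat \<Rightarrow> real"
  assumes super: "\<And>m n. a m + a n \<le> a (m + n) + K" and bound: "\<And>n. a n \<le> B * real n"
  obtains P where "(\<lambda>n. a n / real n) \<longlonglongrightarrow> P" and "\<And>n. a n \<le> real n * P + K"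
proof -
  define b where "b n = a n - K" for n
  have b_super: "b m + b n \<le> b (m + n)" for m n
    using super[of m n] by (simp add: b_def)
  have b_mult: "real q * b N + b r \<le> b (q * N + r)" for q N r
  proof (induction q)
    case (Suc q)
    then show ?case
      using b_super[of N "q * N + r"] by (simp add: algebra_simps)
  qed simp
  \<comment> \<open>The index 0 is left out because there the quotient has the default value
    0.\<close>
  define P where "P = (SUP n\<in>{1..}. b n / real n)"
  have bdd: "bdd_above ((\<lambda>n. b n / real n) ` {1..})"
  proof (rule bdd_aboveI2)
    fix n :: nat assume "n \<in> {1..}"
    then have n: "real n \<ge> 1" by simp
    have "b n \<le> B * real n + \<bar>K\<bar> * real n"
      using bound[of n] mult_left_mono[OF n, of "\<bar>K\<bar>"] by (simp add: b_def)
    then show "b n / real n \<le> B + \<bar>K\<bar>"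
      using n by (simp add: pos_divide_le_eq algebra_simps)
  qed
  have le_P: "b n / real n \<le> P" if "n \<ge> 1" for n
    unfolding P_def using that by (intro cSUP_upper bdd) auto
  have "(\<lambda>n. b n / real n) \<longlonglongrightarrow> P"
  proof (rule order_tendstoI)
    fix x assume "P < x"
    then show "\<forall>\<^sub>F n in sequentially. b n / real n < x"
      using le_P by (intro eventually_sequentiallyI[of 1]) (meson le_less_trans)
  next
    fix x assume "x < P"
    then obtain c where c: "x < c" "c < P"
      using dense by blast
    have "\<exists>N\<in>{1..}. c < b N / real N"
      using c(2) less_cSUP_iff[OF _ bdd, of c] by (simp add: P_def)
    then obtain N where N: "N \<ge> 1" "c < b N / real N"
      by auto
    then have bN: "real N * c \<le> b N"
      by (simp add: pos_less_divide_eq mult.commute)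
    \<comment> \<open>This absorbs the remainder of the division by \<open>N\<close>, uniformly in
      its value \<open>r < N\<close>: both \<open>r * c\<close> and \<open>b r\<close>.\<close>
    define D where "D = real N * \<bar>c\<bar> + (\<Sum>r<N. \<bar>b r\<bar>)"
    have lower: "real n * c - D \<le> b n" for n
    proof -
      define q r where "q = n div N" and "r = n mod N"
      have n: "n = q * N + r" and r: "r < N"
        using N by (auto simp: q_def r_def)
      have "\<bar>b r\<bar> \<le> (\<Sum>r<N. \<bar>b r\<bar>)"
        using r by (intro member_le_sum) auto
      moreover have "real r * c \<le> real N * \<bar>c\<bar>"
      proof -
        have "real r * c \<le> real r * \<bar>c\<bar>"
          by (intro mult_left_mono) auto
        also have "\<dots> \<le> real N * \<bar>c\<bar>"
          using r by (intro mult_right_mono) auto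
        finally show ?thesis .
      qed
      moreover have "real q * (real N * c) \<le> real q * b N"
        using bN by (simp add: mult_left_mono)
      moreover have "real n * c = real q * (real N * c) + real r * c"
        by (simp add: n algebra_simps)
      ultimately show ?thesis
        using b_mult[of q N r] by (simp add: D_def n)
    qed
    have "(\<lambda>n. c - D / real n) \<longlonglongrightarrow> c - 0"
      by (intro tendsto_diff tendsto_const lim_const_over_n)
    then have "\<forall>\<^sub>F n in sequentially. x < c - D / real n"
      using c(1) by (simp add: order_tendstoD(1))
    moreover have "\<forall>\<^sub>F n in sequentially. c - D / real n \<le> b n / real n"
    proof (rule eventually_sequentiallyI[of 1])
      fix n :: nat assume "1 \<le> n"
      then show "c - D / real n \<le> b n / real n"
        using divide_right_mono[OF lower[of n], of "real n"] by (simp add: diff_divide_distrib)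
    qed
    ultimately show "\<forall>\<^sub>F n in sequentially. x < b n / real n"
      by eventually_elim simp
  qed
  from tendsto_add[OF this lim_const_over_n[of K]] have "(\<lambda>n. a n / real n) \<longlonglongrightarrow> P"
    by (simp add: b_def diff_divide_distrib)
  moreover have "a n \<le> real n * P + K" for n
  proof (cases "n = 0")
    case True
    then show ?thesis using super[of 0 0] by simp
  next
    case False
    then show ?thesis using le_P[of n] by (simp add: b_def field_simps)
  qed
  ultimately show thesis by (rule that)
qed

section \<open>Convexity of the exponential by tangent lines\<close>

lemma exp_ge_tangent: "exp a * (1 + u - a) \<le> exp (u::real)"
proof -
  have "exp a * (1 + (u - a)) \<le> exp a * exp (u - a)"
    by (intro mult_left_mono exp_ge_add_one_self) auto
  then show ?thesis by (simp add: algebra_simps flip: exp_add)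
qed

lemma exp_mult_le:
  fixes r u :: real
  assumes "0 \<le> r" "r \<le> 1"
  shows "exp (r * u) \<le> 1 - r + r * exp u"
proof -
  \<comment> \<open>The tangent at \<open>r * u\<close> is evaluated at \<open>u\<close> and at 0;
    with weights \<open>r\<close> and \<open>1 - r\<close> its linear terms cancel.\<close>
  have "exp (r * u) = r * (exp (r * u) * (1 + u - r * u)) + (1 - r) * (exp (r * u) * (1 + 0 - r * u))"
    by (simp add: algebra_simps)
  also have "\<dots> \<le> r * exp u + (1 - r) * exp 0"
    using assms by (intro add_mono mult_left_mono exp_ge_tangent) auto
  finally show ?thesis by simp
qed

text \<open>Power mean inequality for the exponents \<open>s \<le> t\<close>, in logarithmic form
  and cleared of denominators.\<close>

lemma power_mean_exp:
  fixes h :: "'a \<Rightarrow> real"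
  assumes "finite S" "S \<noteq> {}" "0 < s" "s \<le> t"
  shows "t * (ln (\<Sum>y\<in>S. exp (s * h y)) - ln (card S)) \<le> s * (ln (\<Sum>y\<in>S. exp (t * h y)) - ln (card S))"
proof -
  define N where "N = real (card S)"
  define m where "m = ln ((\<Sum>y\<in>S. exp (t * h y)) / N)"
  define r where "r = s / t"
  have r: "0 \<le> r" "r \<le> 1" "t * r = s" and t: "t > 0"
    using assms by (auto simp: r_def)
  have N: "N > 0"
    using assms by (simp add: N_def card_gt_0_iff)
  have pos: "(\<Sum>y\<in>S. exp (c * h y)) > 0" for c
    using assms by (intro sum_pos) auto
  have em: "exp m = (\<Sum>y\<in>S. exp (t * h y)) / N"
    using pos[of t] N by (simp add: m_def)
  \<comment> \<open>Normalizing by \<open>m\<close> makes the mean of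
    \<open>exp (t * h y - m)\<close> equal to 1, so the termwise convexity bound adds up to exactly
    \<open>N\<close>.\<close>
  have "(\<Sum>y\<in>S. exp (s * h y)) * exp (- (r * m)) = (\<Sum>y\<in>S. exp (r * (t * h y - m)))"
    unfolding sum_distrib_right
    by (intro sum.cong refl) (simp add: r(3)[symmetric] algebra_simps flip: exp_add)
  also have "\<dots> \<le> (\<Sum>y\<in>S. 1 - r + r * exp (t * h y - m))"
    by (intro sum_mono exp_mult_le r)
  also have "\<dots> = N * (1 - r) + r * ((\<Sum>y\<in>S. exp (t * h y)) / exp m)"
    by (simp add: sum.distrib N_def exp_diff sum_distrib_left sum_divide_distrib)
  also have "\<dots> = N"
    using N pos[of t] by (simp add: em algebra_simps)
  finally have "(\<Sum>y\<in>S. exp (s * h y)) \<le> N * exp (r * m)"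
    by (simp add: exp_minus field_simps)
  then have "ln (\<Sum>y\<in>S. exp (s * h y)) \<le> ln (N * exp (r * m))"
    using pos N by simp
  also have "\<dots> = ln N + r * m"
    using N by (simp add: ln_mult)
  finally have "t * (ln (\<Sum>y\<in>S. exp (s * h y)) - ln N) \<le> t * (r * m)"
    using t by (intro mult_left_mono) auto
  also have "\<dots> = s * m"
    using r(3) by (simp flip: mult.assoc)
  also have "m = ln (\<Sum>y\<in>S. exp (t * h y)) - ln N"
    using N pos[of t] by (simp add: m_def ln_div)
  finally show ?thesis by (simp add: N_def)
qed

lemma exp_suminf_le:
  fixes p u :: "nat \<Rightarrow> real"
  assumes p: "\<And>k. p k \<ge> 0" "p sums 1" and u: "summable (\<lambda>k. p k * u k)"
    and e: "summable (\<lambda>k. p k * exp (u k))"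
  shows "exp (\<Sum>k. p k * u k) \<le> (\<Sum>k. p k * exp (u k))"
proof -
  define a where "a = (\<Sum>k. p k * u k)"
  \<comment> \<open>Averaging the tangent at the mean \<open>a\<close> leaves \<open>exp a\<close>,
    because the factor \<open>(1 - a) * 1 + a\<close> is 1.\<close>
  have "(\<lambda>k. exp a * ((1 - a) * p k + p k * u k)) sums (exp a * ((1 - a) * 1 + a))"
    unfolding a_def by (intro sums_mult sums_add p summable_sums u)
  moreover have "exp a * ((1 - a) * p k + p k * u k) \<le> p k * exp (u k)" for k
    using mult_left_mono[OF exp_ge_tangent[of a "u k"] p(1)[of k]] by (simp add: algebra_simps)
  ultimately have "exp a * ((1 - a) * 1 + a) \<le> (\<Sum>k. p k * exp (u k))"
    using e by (intro sums_le[OF _ _ summable_sums]) auto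
  then show ?thesis by (simp add: a_def)
qed


section \<open>Estimates for the iterates\<close>

definition iterate :: "real \<Rightarrow> (nat \<Rightarrow> real) \<Rightarrow> real \<Rightarrow> nat \<Rightarrow> real" where
  "iterate \<alpha> z s n = (transfer_op (\<lambda>x. s * dyson \<alpha> x) ^^ n) (\<lambda>_. 1) z"

section \<open>Changing the tail of a configuration\<close>

definition glue :: "nat \<Rightarrow> (nat \<Rightarrow> real) \<Rightarrow> (nat \<Rightarrow> real) \<Rightarrow> nat \<Rightarrow> real" where
  "glue n y z = (\<lambda>i. if i < n then y i else z (i - n))"

lemma glue_Omega: "y \<in> Omega \<Longrightarrow> z \<in> Omega \<Longrightarrow> glue n y z \<in> Omega"
  by (auto simp: Omega_def glue_def)

lemma funpow_shift_glue: "(shift ^^ n) (glue n y z) = z"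
  by (auto simp: funpow_shift glue_def)

lemma glue_fiber: "y \<in> Omega \<Longrightarrow> z \<in> Omega \<Longrightarrow> glue n y z \<in> fiber n z"
  by (simp add: fiber_def glue_Omega funpow_shift_glue)

lemma glue_glue: "glue n (glue n y z') ((shift ^^ n) y) = y"
  by (auto simp: funpow_shift glue_def)

lemma iterate_eq_sum:
  "z \<in> Omega \<Longrightarrow> iterate \<alpha> z s n = (\<Sum>y\<in>fiber n z. exp (s * birkhoff (dyson \<alpha>) n y))"
  by (simp add: iterate_def funpow_transfer_op birkhoff_mult)

lemma iterate_pos: "z \<in> Omega \<Longrightarrow> iterate \<alpha> z s n > 0"
  by (simp add: iterate_def funpow_transfer_op_pos)

text \<open>Exchanging the tail is a bijection between the two fibers, and it moves each Birkhoff
  sum by at most \<open>2 * dyson_moment \<alpha>\<close>.\<close>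

lemma iterate_distortion:
  assumes "\<alpha> > 2" and z: "z \<in> Omega" "z' \<in> Omega"
  shows "iterate \<alpha> z s n \<le> exp (2 * \<bar>s\<bar> * dyson_moment \<alpha>) * iterate \<alpha> z' s n"
proof -
  have "iterate \<alpha> z s n = (\<Sum>y\<in>fiber n z'. exp (s * birkhoff (dyson \<alpha>) n (glue n y z)))"
    unfolding iterate_eq_sum[OF z(1)]
  proof (rule sum.reindex_bij_witness[where i = "\<lambda>y. glue n y z" and j = "\<lambda>y. glue n y z'"])
    show "glue n (glue n y z') z = y" if "y \<in> fiber n z" for y
      using that glue_glue[of n y z'] by (simp add: fiber_def)
    show "glue n (glue n y z) z' = y" if "y \<in> fiber n z'" for y
      using that glue_glue[of n y z] by (simp add: fiber_def)
    then show "exp (s * birkhoff (dyson \<alpha>) n (glue n (glue n y z') z)) = exp (s * birkhoff (dyson \<alpha>) n y)"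
      if "y \<in> fiber n z" for y
      using that glue_glue[of n y z'] by (simp add: fiber_def)
  qed (use z glue_fiber in \<open>auto simp: fiber_def\<close>)
  also have "\<dots> \<le> (\<Sum>y\<in>fiber n z'. exp (2 * \<bar>s\<bar> * dyson_moment \<alpha>) * exp (s * birkhoff (dyson \<alpha>) n y))"
  proof (rule sum_mono)
    fix y assume "y \<in> fiber n z'"
    then have y: "y \<in> Omega" by (simp add: fiber_def)
    let ?S = "birkhoff (dyson \<alpha>) n"
    have "\<bar>?S (glue n y z) - ?S y\<bar> \<le> 2 * dyson_moment \<alpha>"
      using y z by (intro birkhoff_dyson_distortion assms(1) glue_Omega) (auto simp: glue_def)
    then have "\<bar>s\<bar> * \<bar>?S (glue n y z) - ?S y\<bar> \<le> \<bar>s\<bar> * (2 * dyson_moment \<alpha>)"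
      by (intro mult_left_mono) auto
    then have "s * (?S (glue n y z) - ?S y) \<le> \<bar>s\<bar> * (2 * dyson_moment \<alpha>)"
      by (metis abs_le_D1 abs_mult)
    then show "exp (s * ?S (glue n y z)) \<le> exp (2 * \<bar>s\<bar> * dyson_moment \<alpha>) * exp (s * ?S y)"
      by (simp add: algebra_simps flip: exp_add)
  qed
  also have "\<dots> = exp (2 * \<bar>s\<bar> * dyson_moment \<alpha>) * iterate \<alpha> z' s n"
    by (simp add: iterate_eq_sum[OF z(2)] sum_distrib_left)
  finally show ?thesis .
qed

text \<open>In \<open>m + n\<close> steps the inner \<open>n\<close>-step iterate is evaluated at
  varying base points; replacing each of these by \<open>z\<close> costs one distortion
  factor.\<close>

lemma ln_iterate_superadditive:
  assumes "\<alpha> > 2" and z: "z \<in> Omega"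
  shows "ln (iterate \<alpha> z s m) + ln (iterate \<alpha> z s n)
    \<le> ln (iterate \<alpha> z s (m + n)) + 2 * \<bar>s\<bar> * dyson_moment \<alpha>"
proof -
  let ?K = "2 * \<bar>s\<bar> * dyson_moment \<alpha>"
  let ?L = "transfer_op (\<lambda>x. s * dyson \<alpha> x)"
  have "iterate \<alpha> z s m * iterate \<alpha> z s n = (?L ^^ m) (\<lambda>_. iterate \<alpha> z s n) z"
    using funpow_transfer_op_const[OF z, where c = "iterate \<alpha> z s n"] by (simp add: iterate_def)
  also have "\<dots> \<le> (?L ^^ m) (\<lambda>y. exp ?K * iterate \<alpha> y s n) z"
    by (intro funpow_transfer_op_mono iterate_distortion assms)
  also have "\<dots> = exp ?K * (?L ^^ m) (\<lambda>y. iterate \<alpha> y s n) z"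
    by (simp add: funpow_transfer_op[OF z] sum_distrib_left mult_ac)
  also have "(?L ^^ m) (\<lambda>y. iterate \<alpha> y s n) z = iterate \<alpha> z s (m + n)"
    by (simp add: iterate_def funpow_add)
  finally have "ln (iterate \<alpha> z s m * iterate \<alpha> z s n) \<le> ln (exp ?K * iterate \<alpha> z s (m + n))"
    using iterate_pos[OF z] by (subst ln_le_cancel_iff) auto
  moreover have "iterate \<alpha> z s k \<noteq> 0" for k
    using iterate_pos[OF z, of \<alpha> s k] by simp
  ultimately show ?thesis
    by (simp add: ln_mult)
qed

lemma cosh_real_eq: "2 * cosh (c::real) = exp c + exp (- c)"
  by (simp add: cosh_def)

text \<open>
  The sum over the fiber factorizes because \<open>y i * y (i + Suc k)\<close> pairs the symbol \<open>y i\<close> with a later one,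
  so that the symbols can be summed out in increasing order of their indices.
\<close>
lemma sum_exp_corr:
  assumes "z \<in> Omega"
  shows "(\<Sum>y\<in>fiber n z. exp (c * corr n k y)) = (2 * cosh c) ^ n"
proof -
  let ?b = "\<lambda>y::nat \<Rightarrow> real. c * (y 0 * y (Suc k))"
  have "(transfer_op ?b ^^ n) (\<lambda>_. 1) z = (2 * cosh c) ^ n"
  proof (rule funpow_transfer_op_eq_power[OF _ assms])
    fix y assume y: "y \<in> Omega"
    show "transfer_op ?b (\<lambda>_. 1) y = 2 * cosh c"
      \<comment> \<open>Whatever the sign of \<open>y k\<close>, the two preimages contribute
        \<open>exp c\<close> and \<open>exp (- c)\<close> in some order.\<close>
      using Omega_cases[OF y, of k] by (auto simp: transfer_op_Omega[OF y] cosh_real_eq)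
  qed
  moreover have "birkhoff ?b n y = c * corr n k y" for y
    by (simp add: birkhoff_def corr_def funpow_shift sum_distrib_left ac_simps)
  ultimately show ?thesis
    by (simp add: funpow_transfer_op[OF assms])
qed

text \<open>
  Jensen's inequality over the interaction range \<open>k\<close>, with the normalized weights as
  probabilities, reduces to a single range.
\<close>
lemma iterate_le_cosh:
  assumes "\<alpha> > 2" and z: "z \<in> Omega"
  shows "iterate \<alpha> z s n \<le> (2 * cosh (s * dyson_sum \<alpha>)) ^ n"
proof -
  let ?Z = "dyson_sum \<alpha>"
  define p where "p k = dyson_weight \<alpha> k / ?Z" for k
  have Z: "?Z > 0" by (rule dyson_sum_pos[OF assms(1)])
  have p_nonneg: "p k \<ge> 0" for k
    using dyson_weight_pos[of \<alpha> k] Z by (simp add: p_def)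
  have p_sums: "p sums 1"
    using sums_divide[OF summable_sums[OF summable_dyson_weight[OF assms(1)]], where c = ?Z] Z
    by (simp add: p_def[abs_def] dyson_sum_def)
  have summable_p: "summable (\<lambda>k. p k * c k)" if "\<And>k. \<bar>c k\<bar> \<le> B" for c B
    using summable_divide[OF summable_dyson_weight_bounded[OF assms(1) that], where c = ?Z]
    by (simp add: p_def)
  have corr_le: "\<bar>corr n k y\<bar> \<le> real n" if y: "y \<in> Omega" for y k
  proof -
    have "\<bar>corr n k y\<bar> \<le> (\<Sum>i<n. \<bar>y i * y (i + Suc k)\<bar>)"
      unfolding corr_def by (rule sum_abs)
    also have "\<dots> = real n"
      using abs_mult_Omega[OF y] by simp
    finally show ?thesis .
  qed
  have u_le: "\<bar>s * ?Z * corr n k y\<bar> \<le> \<bar>s * ?Z\<bar> * real n" if "y \<in> Omega" for y k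
    unfolding abs_mult[of "s * ?Z"] by (intro mult_left_mono corr_le that) auto
  have e_summable: "summable (\<lambda>k. p k * exp (s * ?Z * corr n k y))" if "y \<in> Omega" for y
  proof (rule summable_p)
    show "\<bar>exp (s * ?Z * corr n k y)\<bar> \<le> exp (\<bar>s * ?Z\<bar> * real n)" for k
      using u_le[OF that, of k] by (simp add: abs_le_iff)
  qed
  have "iterate \<alpha> z s n \<le> (\<Sum>y\<in>fiber n z. \<Sum>k. p k * exp (s * ?Z * corr n k y))"
    unfolding iterate_eq_sum[OF z]
  proof (rule sum_mono)
    fix y assume "y \<in> fiber n z"
    then have y: "y \<in> Omega" by (simp add: fiber_def)
    \<comment> \<open>The factor \<open>dyson_sum \<alpha>\<close> in the exponent cancels the
      normalization of \<open>p\<close>.\<close>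
    have "s * birkhoff (dyson \<alpha>) n y = (\<Sum>k. p k * (s * ?Z * corr n k y))"
      unfolding birkhoff_dyson(1)[OF assms(1) y]
      using suminf_mult[OF birkhoff_dyson(2)[OF assms(1) y, of n], of s] Z
      by (simp add: p_def mult_ac)
    also have "exp \<dots> \<le> (\<Sum>k. p k * exp (s * ?Z * corr n k y))"
      by (intro exp_suminf_le p_nonneg p_sums e_summable[OF y] summable_p[OF u_le[OF y]])
    finally show "exp (s * birkhoff (dyson \<alpha>) n y) \<le> (\<Sum>k. p k * exp (s * ?Z * corr n k y))" .
  qed
  also have "\<dots> = (\<Sum>k. \<Sum>y\<in>fiber n z. p k * exp (s * ?Z * corr n k y))"
    by (rule suminf_sum[symmetric]) (auto simp: fiber_def intro: e_summable)
  also have "\<dots> = (\<Sum>k. p k * (2 * cosh (s * ?Z)) ^ n)"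
    by (simp add: sum_exp_corr[OF z] flip: sum_distrib_left)
  also have "\<dots> = (2 * cosh (s * ?Z)) ^ n"
    using sums_unique[OF sums_mult2[OF p_sums]] by simp
  finally show ?thesis .
qed

text \<open>The four two-letter words are paired by the product of their letters, giving
  \<open>exp s\<close> or \<open>exp (- s)\<close>. Within a pair the influence of \<open>z\<close>
  enters with opposite signs, so it contributes a factor of at least 2.\<close>

lemma two_steps_ge_cosh:
  assumes "\<alpha> > 2" and z: "z \<in> Omega"
  shows "4 * cosh s \<le> iterate \<alpha> z s 2"
proof -
  \<comment> \<open>\<open>u\<close> is the field of \<open>z\<close> on the adjacent letter and
    \<open>v\<close> that on the letter one step further away. The two letters interact with weight
    1.\<close>
  define u where "u = (\<Sum>k. dyson_weight \<alpha> k * z k)"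
  define v where "v = (\<Sum>k. dyson_weight \<alpha> (Suc k) * z k)"
  have d1: "dyson \<alpha> (case_nat a z) = a * u" for a
    by (simp add: dyson_def u_def dyson_weight_def)
  have d2: "dyson \<alpha> (case_nat b (case_nat a z)) = b * (a + v)" if "a = 1 \<or> a = -1" for a b
  proof -
    have "case_nat a z \<in> Omega" using that case_nat_Omega[OF z] by auto
    then have "summable (\<lambda>k. dyson_weight \<alpha> k * case_nat a z k)"
      by (intro summable_dyson_weight_bounded[OF assms(1), where B = 1]) (simp add: abs_Omega)
    from suminf_split_head[OF this] show ?thesis
      by (simp add: dyson_def v_def dyson_weight_def)
  qed
  have e: "2 \<le> exp x + exp (- x)" for x :: real
    using cosh_real_ge_1[of x] cosh_real_eq[of x] by linarith
  have "4 * cosh s = exp s * 2 + exp (- s) * 2"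
    using cosh_real_eq[of s] by simp
  also have "\<dots> \<le> exp s * (exp (s * u + s * v) + exp (- (s * u + s * v)))
      + exp (- s) * (exp (s * u - s * v) + exp (- (s * u - s * v)))"
    by (intro add_mono mult_left_mono e) auto
  also have "\<dots> = iterate \<alpha> z s 2"
    using case_nat_Omega[OF z]
    by (simp add: iterate_def numeral_2_eq_2 transfer_op_Omega z d1 d2 algebra_simps flip: exp_add)
  finally show ?thesis .
qed

text \<open>
  The words \<open>(-1)\<^sup>m 1\<^sup>n\<^sup>-\<^sup>m\<close> lose only a bounded amount of energy against the ground state, and there
  are \<open>n\<close> of them.
\<close>
lemma iterate_ge_domain_walls:
  assumes "\<alpha> > 2" and z: "z \<in> Omega" and "s \<ge> 0"
  shows "real n * exp (s * (real n * dyson_sum \<alpha> - 4 * dyson_moment \<alpha>)) \<le> iterate \<alpha> z s n"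
proof -
  let ?S = "birkhoff (dyson \<alpha>)"
  \<comment> \<open>The second block fills up to length \<open>n\<close>, so the tail is
    \<open>z\<close>; \<open>m = 0\<close> gives the word without a wall.\<close>
  define w where "w m = glue m (\<lambda>_. -1) (glue (n - m) (\<lambda>_. 1) z)" for m
  have w_fiber: "w m \<in> fiber n z" if "m < n" for m
    using that z const_Omega
    by (auto simp: w_def fiber_def glue_Omega) (auto simp: funpow_shift glue_def)
  have w_Omega: "w m \<in> Omega" for m
    using z const_Omega by (simp add: w_def glue_Omega)
  have inj: "inj_on w {..<n}"
  proof (rule linorder_inj_onI')
    fix i j assume "i \<in> {..<n}" "j \<in> {..<n}" "i < j"
    then have "w i i = 1" "w j i = -1"
      by (auto simp: w_def glue_def)
    then show "w i \<noteq> w j" by auto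
  qed
  \<comment> \<open>Each of the two blocks is compared with its constant configuration at a cost of
    \<open>2 * dyson_moment \<alpha>\<close>; hence the 4.\<close>
  have S_ge: "real n * dyson_sum \<alpha> - 4 * dyson_moment \<alpha> \<le> ?S n (w m)" if m: "m < n" for m
  proof -
    have "?S n (w m) = ?S m (w m) + ?S (n - m) ((shift ^^ m) (w m))"
      using birkhoff_add[of "dyson \<alpha>" m "n - m"] m by simp
    moreover have "\<bar>?S m (w m) - ?S m (\<lambda>_. -1)\<bar> \<le> 2 * dyson_moment \<alpha>"
      by (intro birkhoff_dyson_distortion assms(1) w_Omega const_Omega) (simp add: w_def glue_def)
    moreover have "\<bar>?S (n - m) ((shift ^^ m) (w m)) - ?S (n - m) (\<lambda>_. 1)\<bar> \<le> 2 * dyson_moment \<alpha>"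
      by (intro birkhoff_dyson_distortion assms(1) funpow_shift_Omega w_Omega const_Omega)
        (simp add: w_def glue_def funpow_shift)
    moreover have "?S m (\<lambda>_. -1) = real m * dyson_sum \<alpha>"
      "?S (n - m) (\<lambda>_. 1) = real (n - m) * dyson_sum \<alpha>"
      using birkhoff_dyson_const[OF assms(1)] by auto
    moreover have "real n * dyson_sum \<alpha> = real m * dyson_sum \<alpha> + real (n - m) * dyson_sum \<alpha>"
      using m by (simp add: of_nat_diff flip: distrib_right)
    ultimately show ?thesis by linarith
  qed
  have "real n * exp (s * (real n * dyson_sum \<alpha> - 4 * dyson_moment \<alpha>))
      = (\<Sum>m<n. exp (s * (real n * dyson_sum \<alpha> - 4 * dyson_moment \<alpha>)))"
    by simp
  also have "\<dots> \<le> (\<Sum>m<n. exp (s * ?S n (w m)))"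
    using \<open>s \<ge> 0\<close> by (intro sum_mono) (simp add: mult_left_mono S_ge)
  also have "\<dots> = (\<Sum>y\<in>w ` {..<n}. exp (s * ?S n y))"
    by (simp add: sum.reindex[OF inj])
  also have "\<dots> \<le> iterate \<alpha> z s n"
    unfolding iterate_eq_sum[OF z] using w_fiber by (intro sum_mono2 finite_fiber z) auto
  finally show ?thesis .
qed


section \<open>The pressure\<close>

text \<open>The cosh bound supplies the linear growth that the Fekete argument requires. The second
  claim keeps an error independent of \<open>n\<close>.\<close>

lemma pressure_limit:
  assumes "\<alpha> > 2" and z: "z \<in> Omega"
  shows "(\<lambda>n. ln (iterate \<alpha> z s n) / real n) \<longlonglongrightarrow> pressure \<alpha> z s"
    and "ln (iterate \<alpha> z s n) \<le> real n * pressure \<alpha> z s + 2 * \<bar>s\<bar> * dyson_moment \<alpha>"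
proof -
  have "ln (iterate \<alpha> z s n) \<le> ln (2 * cosh (s * dyson_sum \<alpha>)) * real n" for n
  proof -
    have "ln (iterate \<alpha> z s n) \<le> ln ((2 * cosh (s * dyson_sum \<alpha>)) ^ n)"
      using iterate_le_cosh[OF assms] iterate_pos[OF z] by (subst ln_le_cancel_iff) auto
    also have "\<dots> = ln (2 * cosh (s * dyson_sum \<alpha>)) * real n"
      by (subst ln_realpow) simp_all
    finally show ?thesis .
  qed
  from quasi_superadditive_limit[OF ln_iterate_superadditive[OF assms] this]
  obtain P where P: "(\<lambda>n. ln (iterate \<alpha> z s n) / real n) \<longlonglongrightarrow> P"
    "\<And>n. ln (iterate \<alpha> z s n) \<le> real n * P + 2 * \<bar>s\<bar> * dyson_moment \<alpha>"
    by blast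
  have "pressure \<alpha> z s = P"
    unfolding pressure_def using P(1) by (intro limI) (simp add: iterate_def)
  then show "(\<lambda>n. ln (iterate \<alpha> z s n) / real n) \<longlonglongrightarrow> pressure \<alpha> z s"
    and "ln (iterate \<alpha> z s n) \<le> real n * pressure \<alpha> z s + 2 * \<bar>s\<bar> * dyson_moment \<alpha>"
    using P by auto
qed

lemma pressure_le:
  assumes "\<alpha> > 2" and z: "z \<in> Omega"
  shows "pressure \<alpha> z s \<le> ln 2 + ln (cosh (s * dyson_sum \<alpha>))"
proof (rule LIMSEQ_le_const2[OF pressure_limit(1)[OF assms]])
  have "ln (iterate \<alpha> z s n) / real n \<le> ln 2 + ln (cosh (s * dyson_sum \<alpha>))" if "n \<ge> 1" for n
  proof -
    have "ln (iterate \<alpha> z s n) \<le> ln ((2 * cosh (s * dyson_sum \<alpha>)) ^ n)"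
      using iterate_le_cosh[OF assms] iterate_pos[OF z] by (subst ln_le_cancel_iff) auto
    also have "\<dots> = real n * (ln 2 + ln (cosh (s * dyson_sum \<alpha>)))"
      by (simp add: ln_realpow ln_mult distrib_left)
    finally show ?thesis using that by (simp add: pos_divide_le_eq mult.commute)
  qed
  then show "\<exists>N. \<forall>n\<ge>N. ln (iterate \<alpha> z s n) / real n \<le> ln 2 + ln (cosh (s * dyson_sum \<alpha>))"
    by blast
qed

lemma pressure_ge:
  assumes "\<alpha> > 2" and z: "z \<in> Omega"
  shows "ln 2 + ln (cosh s) / 2 \<le> pressure \<alpha> z s"
proof (rule LIMSEQ_le_const)
  \<comment> \<open>The lower bound advances two steps at a time, so the limit is taken along even
    indices.\<close>
  have "strict_mono (\<lambda>n::nat. n * 2)"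
    by (simp add: strict_mono_def)
  from LIMSEQ_subseq_LIMSEQ[OF pressure_limit(1)[OF assms] this]
  show "(\<lambda>n. ln (iterate \<alpha> z s (n * 2)) / real (n * 2)) \<longlonglongrightarrow> pressure \<alpha> z s"
    by (simp add: o_def)
  have "ln 2 + ln (cosh s) / 2 \<le> ln (iterate \<alpha> z s (n * 2)) / real (n * 2)" if "n \<ge> 1" for n
  proof -
    have "(4 * cosh s) ^ n \<le> iterate \<alpha> z s (n * 2)"
      unfolding iterate_def
      using two_steps_ge_cosh[OF assms(1), of _ s] cosh_real_ge_1[of s]
      by (intro funpow_transfer_op_power_ge z) (auto simp: iterate_def)
    then have "ln ((4 * cosh s) ^ n) \<le> ln (iterate \<alpha> z s (n * 2))"
      using iterate_pos[OF z] by (subst ln_le_cancel_iff) auto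
    moreover have "ln ((4 * cosh s) ^ n) = real (n * 2) * (ln 2 + ln (cosh s) / 2)"
      using ln_realpow[of 2 2] by (simp add: ln_realpow ln_mult algebra_simps)
    ultimately show ?thesis using that by (simp add: pos_le_divide_eq mult.commute)
  qed
  then show "\<exists>N. \<forall>n\<ge>N. ln 2 + ln (cosh s) / 2 \<le> ln (iterate \<alpha> z s (n * 2)) / real (n * 2)"
    by blast
qed

text \<open>The power mean inequality over the fiber, whose \<open>2 ^ n\<close> points produce the
  \<open>ln 2\<close>, passes to the limit.\<close>

lemma pressure_power_mean:
  assumes "\<alpha> > 2" and z: "z \<in> Omega" and "0 < s" "s \<le> t"
  shows "t * (pressure \<alpha> z s - ln 2) \<le> s * (pressure \<alpha> z t - ln 2)"
proof (rule LIMSEQ_le)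
  show "(\<lambda>n. t * (ln (iterate \<alpha> z s n) / real n - ln 2)) \<longlonglongrightarrow> t * (pressure \<alpha> z s - ln 2)"
    and "(\<lambda>n. s * (ln (iterate \<alpha> z t n) / real n - ln 2)) \<longlonglongrightarrow> s * (pressure \<alpha> z t - ln 2)"
    by (intro tendsto_intros pressure_limit(1) assms)+
  have "t * (ln (iterate \<alpha> z s n) / real n - ln 2) \<le> s * (ln (iterate \<alpha> z t n) / real n - ln 2)"
    if "n \<ge> 1" for n
  proof -
    have "t * (ln (iterate \<alpha> z s n) - real n * ln 2) \<le> s * (ln (iterate \<alpha> z t n) - real n * ln 2)"
      using power_mean_exp[OF finite_fiber[OF z] fiber_nonempty[OF z] assms(3,4)]
      by (simp add: iterate_eq_sum[OF z] card_fiber[OF z] ln_realpow)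
    then have "t * (ln (iterate \<alpha> z s n) - real n * ln 2) / real n
        \<le> s * (ln (iterate \<alpha> z t n) - real n * ln 2) / real n"
      by (rule divide_right_mono) simp
    then show ?thesis using that by (simp add: diff_divide_distrib right_diff_distrib)
  qed
  then show "\<exists>N. \<forall>n\<ge>N. t * (ln (iterate \<alpha> z s n) / real n - ln 2) \<le> s * (ln (iterate \<alpha> z t n) / real n - ln 2)"
    by blast
qed

lemma pressure_gt_ground_state:
  assumes "\<alpha> > 2" and z: "z \<in> Omega" and "s \<ge> 0"
  shows "s * dyson_sum \<alpha> < pressure \<alpha> z s"
proof -
  \<comment> \<open>Four moments are lost to the domain walls and two in the finite-\<open>n\<close>
    pressure bound. A single \<open>n\<close> with \<open>ln n > D\<close> then suffices.\<close>
  define D where "D = 6 * s * dyson_moment \<alpha>"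
  obtain n :: nat where n: "exp D < real n"
    using reals_Archimedean2 by blast
  then have pos: "0 < real n"
    using exp_gt_zero[of D] by linarith
  have "D < ln (real n)"
    using n pos by (metis exp_less_cancel_iff exp_ln)
  moreover have "ln (real n * exp (s * (real n * dyson_sum \<alpha> - 4 * dyson_moment \<alpha>)))
      \<le> ln (iterate \<alpha> z s n)"
    using iterate_ge_domain_walls[OF assms] iterate_pos[OF z] pos by (subst ln_le_cancel_iff) auto
  then have "ln (real n) + s * (real n * dyson_sum \<alpha> - 4 * dyson_moment \<alpha>) \<le> ln (iterate \<alpha> z s n)"
    using pos by (simp add: ln_mult)
  ultimately have "real n * (s * dyson_sum \<alpha>) < real n * pressure \<alpha> z s"
    using pressure_limit(2)[OF assms(1) z, of s n] \<open>s \<ge> 0\<close> by (simp add: D_def algebra_simps)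
  then show ?thesis
    using pos by simp
qed

lemma pressure_0: "\<alpha> > 2 \<Longrightarrow> z \<in> Omega \<Longrightarrow> pressure \<alpha> z 0 = ln 2"
  using pressure_le[of \<alpha> z 0] pressure_ge[of \<alpha> z 0] by simp

text \<open>The two-sided bounds give a deviation from \<open>ln 2\<close> of at most
  \<open>cosh (h * dyson_sum \<alpha>) - 1\<close>, which is of smaller order than
  \<open>h\<close>.\<close>

lemma pressure_has_derivative_0:
  assumes "\<alpha> > 2" and z: "z \<in> Omega"
  shows "(pressure \<alpha> z has_real_derivative 0) (at 0)"
proof -
  let ?Z = "dyson_sum \<alpha>"
  have "((\<lambda>h. cosh (h * ?Z)) has_real_derivative 0) (at 0)"
    by (auto intro!: derivative_eq_intros)
  then have lim: "((\<lambda>h. (cosh (h * ?Z) - 1) / h) \<longlongrightarrow> 0) (at 0)"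
    by (simp add: DERIV_def)
  have "((\<lambda>h. (pressure \<alpha> z h - ln 2) / h) \<longlongrightarrow> 0) (at 0)"
  \<comment> \<open>The comparison holds for every \<open>h\<close>, including 0, where both
    quotients are 0 by default.\<close>
  proof (rule Lim_null_comparison[OF _ tendsto_norm_zero[OF lim]], rule always_eventually, rule allI)
    fix h :: real
    have "0 \<le> ln (cosh h)"
      using cosh_real_ge_1[of h] by simp
    moreover have "ln (cosh (h * ?Z)) \<le> cosh (h * ?Z) - 1"
      by (rule ln_le_minus_one) simp
    ultimately have "\<bar>pressure \<alpha> z h - ln 2\<bar> \<le> \<bar>cosh (h * ?Z) - 1\<bar>"
      using pressure_ge[OF assms, of h] pressure_le[OF assms, of h] by linarith
    then show "norm ((pressure \<alpha> z h - ln 2) / h) \<le> norm ((cosh (h * ?Z) - 1) / h)"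
      by (simp add: divide_right_mono)
  qed
  then show ?thesis
    by (simp add: DERIV_def pressure_0[OF assms])
qed

lemma strict_mono_on_pressure:
  assumes "\<alpha> > 2" and z: "z \<in> Omega"
  shows "strict_mono_on {0..} (pressure \<alpha> z)"
proof (rule strict_mono_onI)
  fix s t :: real assume st: "s \<in> {0..}" "t \<in> {0..}" "s < t"
  then have "1 < cosh t"
    using cosh_real_strict_mono[of 0 t] by simp
  then have t: "ln 2 < pressure \<alpha> z t"
    using pressure_ge[OF assms, of t] ln_gt_zero[of "cosh t"] by linarith
  show "pressure \<alpha> z s < pressure \<alpha> z t"
  proof (cases "s = 0")
    case True
    then show ?thesis using t pressure_0[OF assms] by simp
  next
    case False
    then have "t * (pressure \<alpha> z s - ln 2) \<le> s * (pressure \<alpha> z t - ln 2)"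
      using st by (intro pressure_power_mean assms) auto
    \<comment> \<open>Strictness comes from the pressure at \<open>t\<close> exceeding
      \<open>ln 2\<close>.\<close>
    also have "\<dots> < t * (pressure \<alpha> z t - ln 2)"
      using st t by (intro mult_strict_right_mono) auto
    finally show ?thesis using st by simp
  qed
qed

theorem lemma5p1:
  fixes \<alpha> :: real and z\<^sub>0 :: "nat \<Rightarrow> real"
  assumes "\<alpha> > 2" and "z\<^sub>0 \<in> Omega"
  shows "strict_mono_on {0..} (pressure \<alpha> z\<^sub>0) \<and>
         (pressure \<alpha> z\<^sub>0 has_real_derivative 0) (at 0) \<and>
         pressure \<alpha> z\<^sub>0 0 = ln 2 \<and>
         (\<forall>s\<ge>0. pressure \<alpha> z\<^sub>0 s > s * (GREATEST v. v \<in> dyson \<alpha> ` Omega))"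
  using strict_mono_on_pressure[OF assms] pressure_has_derivative_0[OF assms] pressure_0[OF assms]
    pressure_gt_ground_state[OF assms] Greatest_dyson[OF assms(1)]
  by simp

end
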